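(* Let $s\in(0,1)$, $k\in\mathbb{N}$, and let $u:\mathbb{R}^n\to\mathbb{R}$ be continuous in $B_1$ with $\int_{\mathbb{R}^n}\frac{|u(y)|}{1+|y|^{n+2s+k}}\,dy<+\infty$. Let $f,\tilde f:B_1\to\mathbb{R}$ and assume that $(-\Delta)^s u\overset{k}{=}f$ and $(-\Delta)^s u\overset{k}{=}\tilde f$ in $B_1$. Then there exists a polynomial $P$ of degree at most $k-1$ such that $f-\tilde f=P$.
   Context: $\mathbb{N}=\{0,1,2,\dots\}$; $B_r$ is the ball of radius $r$ centered at the origin of $\mathbb{R}^n$; polynomials of negative degree are set to be zero. For $s\in(0,1)$, the fractional Laplacian is $(-\Delta)^s w(x):=\lim_{\varepsilon\to0}\int_{\mathbb{R}^n\setminus B_\varepsilon(x)}\frac{w(x)-w(y)}{|x-y|^{n+2s}}\,dy$. Let $\chi_R$ be the function equal to $1$ in $B_R$ and to $0$ elsewhere. Definition of $\overset{k}{=}$: let $k\in\mathbb{N}$, $f:B_1\to\mathbb{R}$ and $u:\mathbb{R}^n\to\mathbb{R}$, with $u$ continuous in $B_1$ and $\int_{\mathbb{R}^n}\frac{|u(y)|}{1+|y|^{n+2s+k}}\,dy<+\infty$. One says that $(-\Delta)^s u\overset{k}{=}f$ in $B_1$ if there exist a family of polynomials $P_R$, which have degree at most $k-1$, and functions $f_R:B_1\to\mathbb{R}$ such that $(-\Delta)^s(\chi_R u)=f_R+P_R$ in $B_1$ in the viscosity sense (the usual notion of viscosity solution for the fractional Laplacian), with $\lim_{R\to+\infty}f_R(x)=f(x)$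 for any $x\in B_1$.
   Formalization: The viscosity sense is taken with continuous right-hand side f_R+P_R in B_1; without this, f is arbitrary at points where no C^2 function touches u (e.g. u=sign(x)|x|^a near 0, 0<a<1, n=1, k=0) and the claim fails. *)

theory Defs
  imports "HOL-Analysis.Analysis"
begin

definition frac_laplacian :: "real \<Rightarrow> (real^'n \<Rightarrow> real) \<Rightarrow> real^'n \<Rightarrow> real" where
  "frac_laplacian s w x =
     Lim (at_right 0) (\<lambda>\<epsilon>. LINT y : - ball x \<epsilon> | lebesgue.
       (w x - w y) / norm (x - y) powr (real CARD('n) + 2 * s))"

text \<open>Real polynomial functions on \<open>\<real>\<^sup>n\<close> of degree at most \<open>k - 1\<close>, written with multi-indices
  \<open>\<alpha>\<close> satisfying \<open>\<bar>\<alpha>\<bar> < k\<close>. For \<open>k = 0\<close> the sum is empty, so that the only polynomial of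
  negative degree is zero. The lemma below shows that the sum is always a finite one.\<close>

definition poly_degree_less :: "nat \<Rightarrow> (real^'n \<Rightarrow> real) \<Rightarrow> bool" where
  "poly_degree_less k p \<longleftrightarrow>
     (\<exists>c :: ('n \<Rightarrow> nat) \<Rightarrow> real. \<forall>x.
        p x = (\<Sum>\<alpha> | sum \<alpha> UNIV < k. c \<alpha> * (\<Prod>i\<in>UNIV. (x $ i) ^ \<alpha> i)))"

lemma finite_multi_indices: "finite {\<alpha> :: 'n::finite \<Rightarrow> nat. sum \<alpha> UNIV < k}"
proof (rule finite_subset)
  have "\<alpha> i < k" if "sum \<alpha> UNIV < k" for \<alpha> :: "'n \<Rightarrow> nat" and i
    using member_le_sum[of i UNIV \<alpha>] that by simp
  then show "{\<alpha> :: 'n \<Rightarrow> nat. sum \<alpha> UNIV < k} \<subseteq> (\<Pi>\<^sub>E i\<in>UNIV. {..<k})"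
    by auto
qed (auto intro: finite_PiE)

text \<open>Twice continuous differentiability on an open set, through gradient \<open>G\<close> and Hessian \<open>H\<close>.\<close>

definition C2_on :: "(real^'n) set \<Rightarrow> (real^'n \<Rightarrow> real) \<Rightarrow> bool" where
  "C2_on U \<phi> \<longleftrightarrow> open U \<and>
     (\<exists>(G :: real^'n \<Rightarrow> real^'n) (H :: real^'n \<Rightarrow> real^'n^'n).
        (\<forall>x\<in>U. (\<phi> has_derivative (\<lambda>h. G x \<bullet> h)) (at x)) \<and>
        (\<forall>x\<in>U. (G has_derivative (\<lambda>h. H x *v h)) (at x)) \<and>
        continuous_on U H)"

text \<open>Viscosity solutions of \<open>(-\<Delta>)\<^sup>s w = g\<close>. At \<open>x\<close> the function \<open>w\<close> is replaced, in a
  neighbourhood \<open>N\<close> of \<open>x\<close>, by a function \<open>\<phi>\<close> that is \<open>C\<^sup>2\<close> up to the boundary of \<open>N\<close> (that is,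
  in a neighbourhood \<open>U\<close> of the closure) and touches \<open>w\<close> at \<open>x\<close> from above or from below.\<close>

definition touches_above ::
  "(real^'n) set \<Rightarrow> (real^'n \<Rightarrow> real) \<Rightarrow> real^'n \<Rightarrow> (real^'n) set \<Rightarrow> (real^'n \<Rightarrow> real) \<Rightarrow> bool" where
  "touches_above \<Omega> w x N \<phi> \<longleftrightarrow>
     open N \<and> x \<in> N \<and> N \<subseteq> \<Omega> \<and> (\<exists>U. closure N \<subseteq> U \<and> C2_on U \<phi>) \<and>
     \<phi> x = w x \<and> (\<forall>y\<in>N. w y \<le> \<phi> y)"

definition touches_below ::
  "(real^'n) set \<Rightarrow> (real^'n \<Rightarrow> real) \<Rightarrow> real^'n \<Rightarrow> (real^'n) set \<Rightarrow> (real^'n \<Rightarrow> real) \<Rightarrow> bool" where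
  "touches_below \<Omega> w x N \<phi> \<longleftrightarrow>
     open N \<and> x \<in> N \<and> N \<subseteq> \<Omega> \<and> (\<exists>U. closure N \<subseteq> U \<and> C2_on U \<phi>) \<and>
     \<phi> x = w x \<and> (\<forall>y\<in>N. \<phi> y \<le> w y)"

definition viscosity_subsolution ::
  "real \<Rightarrow> (real^'n) set \<Rightarrow> (real^'n \<Rightarrow> real) \<Rightarrow> (real^'n \<Rightarrow> real) \<Rightarrow> bool" where
  "viscosity_subsolution s \<Omega> w g \<longleftrightarrow>
     (\<forall>x\<in>\<Omega>. \<forall>N \<phi>. touches_above \<Omega> w x N \<phi> \<longrightarrow>
        frac_laplacian s (\<lambda>y. if y \<in> N then \<phi> y else w y) x \<le> g x)"

definition viscosity_supersolution ::
  "real \<Rightarrow> (real^'n) set \<Rightarrow> (real^'n \<Rightarrow> real) \<Rightarrow> (real^'n \<Rightarrow> real) \<Rightarrow> bool" where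
  "viscosity_supersolution s \<Omega> w g \<longleftrightarrow>
     (\<forall>x\<in>\<Omega>. \<forall>N \<phi>. touches_below \<Omega> w x N \<phi> \<longrightarrow>
        g x \<le> frac_laplacian s (\<lambda>y. if y \<in> N then \<phi> y else w y) x)"

text \<open>As usual for viscosity solutions, both the solution and the right-hand side are continuous in
  \<open>\<Omega>\<close>. Continuity of \<open>g\<close> matters: at a point where no \<open>C\<^sup>2\<close> function touches \<open>w\<close>, the two
  one-sided conditions say nothing about the value of \<open>g\<close>.\<close>

definition viscosity_solution ::
  "real \<Rightarrow> (real^'n) set \<Rightarrow> (real^'n \<Rightarrow> real) \<Rightarrow> (real^'n \<Rightarrow> real) \<Rightarrow> bool" where
  "viscosity_solution s \<Omega> w g \<longleftrightarrow>
     continuous_on \<Omega> w \<and> continuous_on \<Omega> g \<and>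
     viscosity_subsolution s \<Omega> w g \<and> viscosity_supersolution s \<Omega> w g"

text \<open>The relation \<open>(-\<Delta>)\<^sup>s u = f\<close> in \<open>B\<^sub>1\<close> up to polynomials of degree at most \<open>k - 1\<close>. The
  equation for the truncation \<open>\<chi>\<^sub>R u\<close> is required for all large \<open>R\<close>: the notion concerns
  \<open>R \<rightarrow> \<infinity>\<close>, and for \<open>R < 1\<close> the truncation in general jumps inside \<open>B\<^sub>1\<close>.
  Only the values of \<open>f\<close> in \<open>B\<^sub>1\<close> are relevant.\<close>

definition frac_laplacian_eq_mod ::
  "real \<Rightarrow> nat \<Rightarrow> (real^'n \<Rightarrow> real) \<Rightarrow> (real^'n \<Rightarrow> real) \<Rightarrow> bool" where
  "frac_laplacian_eq_mod s k u f \<longleftrightarrow>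
     (\<exists>(P :: real \<Rightarrow> real^'n \<Rightarrow> real) (F :: real \<Rightarrow> real^'n \<Rightarrow> real).
        (\<forall>R. poly_degree_less k (P R)) \<and>
        (\<forall>\<^sub>F R in at_top.
           viscosity_solution s (ball 0 1) (\<lambda>y. indicator (ball 0 R) y * u y) (\<lambda>x. F R x + P R x)) \<and>
        (\<forall>x\<in>ball 0 1. ((\<lambda>R. F R x) \<longlongrightarrow> f x) at_top))"

end

theory Submission
  imports Defs
begin

text \<open>For large \<open>R\<close> the truncation \<open>w = \<chi>\<^sub>R u\<close> is integrable and solves the equation in \<open>B\<^sub>1\<close> with both
  right-hand sides \<open>F\<^sub>R + P\<^sub>R\<close> and \<open>F'\<^sub>R + P'\<^sub>R\<close>. A viscosity solution determines its continuous
  right-hand side, by doubling of variables: if \<open>(x, y)\<close> maximizes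
  \<open>w x - w y - m \<bar>x - y\<bar>\<^sup>2 - \<kappa> \<bar>x - x\<^sub>0\<bar>\<^sup>2\<close>, quadratics touch \<open>w\<close> at \<open>x\<close> from above and at \<open>y\<close> from
  below. Using them on a ball of radius \<open>\<delta>\<close> and letting first \<open>\<delta> \<rightarrow> 0\<close>, then \<open>m \<rightarrow> \<infinity>\<close> and
  \<open>\<kappa> \<rightarrow> 0\<close> compares the two right-hand sides at \<open>x\<^sub>0\<close>; no second-order theory is needed, because the
  kernel makes the contribution of the ball \<open>O(\<delta>\<^bsup>2-2s\<^esup>)\<close>. Hence \<open>F\<^sub>R - F'\<^sub>R = P'\<^sub>R - P\<^sub>R\<close>, and a
  pointwise limit of polynomials of bounded degree is again such a polynomial.\<close>

subsection \<open>Integrability of powers of the norm\<close>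

text \<open>The map z -> a + c z has Jacobian |c|^n = 1, so it pushes Lebesgue measure forward to
  itself. The case c = 1 recentres integrals at a point; c = -1 is the reflection that annihilates
  odd integrands.\<close>

lemma
  fixes f :: "'a::euclidean_space \<Rightarrow> real"
  assumes "f \<in> borel_measurable lebesgue" and "\<bar>c\<bar> = 1"
  shows lebesgue_integral_isometry: "(LINT z|lebesgue. f (a + c *\<^sub>R z)) = (LINT y|lebesgue. f y)"
    and lebesgue_integrable_isometry:
      "integrable lebesgue (\<lambda>z. f (a + c *\<^sub>R z)) \<longleftrightarrow> integrable lebesgue f"
    and lebesgue_measurable_isometry: "(\<lambda>z. f (a + c *\<^sub>R z)) \<in> borel_measurable lebesgue"
proof -
  have c: "c \<noteq> 0" using assms(2) by auto
  have T: "(\<lambda>x. a + (\<Sum>j\<in>Basis. (c * (x \<bullet> j)) *\<^sub>R j)) = (\<lambda>x. a + c *\<^sub>R x)"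
    by (simp add: scaleR_scaleR[symmetric] scaleR_sum_right[symmetric] euclidean_representation
        del: scaleR_scaleR)
  have m: "(\<lambda>x. a + c *\<^sub>R x) \<in> lebesgue \<rightarrow>\<^sub>M lebesgue"
    using lebesgue_affine_measurable[of "\<lambda>_. c" a] c unfolding T by simp
  have d: "lebesgue = distr lebesgue lebesgue (\<lambda>x. a + c *\<^sub>R x)"
    using lebesgue_affine_euclidean[of "\<lambda>_. c" a] c assms(2) unfolding T
    by (simp add: density_1 flip: one_ennreal_def)
  show "(LINT z|lebesgue. f (a + c *\<^sub>R z)) = (LINT y|lebesgue. f y)"
    using integral_distr[OF m assms(1)] d by metis
  show "integrable lebesgue (\<lambda>z. f (a + c *\<^sub>R z)) \<longleftrightarrow> integrable lebesgue f"
    using integrable_distr_eq[OF m assms(1)] d by metis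
  show "(\<lambda>z. f (a + c *\<^sub>R z)) \<in> borel_measurable lebesgue"
    using m assms(1) by (rule measurable_compose)
qed

lemma ball_measurable [measurable]: "ball (x::'a::metric_space) r \<in> sets borel"
  by simp

text \<open>Applied to the dyadic balls, which turn integrability of powers of the norm into the
  convergence of a geometric series.\<close>

lemma nn_integral_le_sum_balls:
  fixes f :: "'a::euclidean_space \<Rightarrow> real" and r a :: "nat \<Rightarrow> real"
  assumes cover: "\<And>x. f x \<noteq> 0 \<Longrightarrow> \<exists>j. norm x < r j \<and> f x \<le> a j"
    and a: "\<And>j. 0 \<le> a j" and r: "\<And>j. 0 \<le> r j"
    and S: "(\<lambda>j. a j * r j ^ DIM('a)) sums S"
  shows "(\<integral>\<^sup>+x. ennreal (f x) \<partial>lebesgue) \<le> ennreal (unit_ball_vol DIM('a) * S)"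
proof -
  have "(\<integral>\<^sup>+x. ennreal (f x) \<partial>lebesgue)
      \<le> (\<integral>\<^sup>+x. (\<Sum>j. ennreal (a j) * indicator (ball 0 (r j)) x) \<partial>(lebesgue :: 'a measure))"
  proof (rule nn_integral_mono)
    fix x :: 'a
    show "ennreal (f x) \<le> (\<Sum>j. ennreal (a j) * indicator (ball 0 (r j)) x)"
    proof (cases "f x = 0")
      case False
      then obtain j where "norm x < r j" "f x \<le> a j" using cover by blast
      then have "ennreal (f x) \<le> (\<Sum>i\<in>{j}. ennreal (a i) * indicator (ball 0 (r i)) x)"
        by (simp add: ennreal_leI)
      also have "\<dots> \<le> (\<Sum>j. ennreal (a j) * indicator (ball 0 (r j)) x)"
        by (intro sum_le_suminf) auto
      finally show ?thesis .
    qed simp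
  qed
  also have "\<dots> = (\<Sum>j. \<integral>\<^sup>+x. ennreal (a j) * indicator (ball 0 (r j)) x \<partial>(lebesgue :: 'a measure))"
    by (intro nn_integral_suminf measurable_completion) measurable
  also have "\<dots> = (\<Sum>j. ennreal (a j * (unit_ball_vol DIM('a) * r j ^ DIM('a))))"
    using a r
    by (intro suminf_cong, subst nn_integral_cmult_indicator) (auto simp: emeasure_ball ennreal_mult')
  also have "\<dots> = ennreal (unit_ball_vol DIM('a) * S)"
    using sums_mult[OF S, of "unit_ball_vol DIM('a)"] a r
    by (intro suminf_ennreal_eq) (auto simp: mult_ac intro!: mult_nonneg_nonneg)
  finally show ?thesis .
qed

text \<open>On the shell 2^j \<rho> \<le> |z| < 2^(j+1) \<rho> the integrand is at most its value at
  the inner radius, and the volume is bounded by that of the outer ball. The resulting series is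
  geometric with ratio 2^(n-p) < 1.\<close>

lemma powr_tail_integrable:
  assumes p: "real DIM('a) < p" and \<rho>: "0 < \<rho>"
  shows "integrable lebesgue
    (\<lambda>z::'a::euclidean_space. indicator (- ball 0 \<rho>) z * norm z powr (- p))"
proof -
  let ?n = "real DIM('a)"
  let ?f = "\<lambda>z::'a. indicator (- ball 0 \<rho>) z * norm z powr (- p)"
  let ?a = "\<lambda>j::nat. (2 ^ j * \<rho>) powr (- p)" and ?r = "\<lambda>j::nat. 2 ^ Suc j * \<rho>"
  have "?a j * ?r j ^ DIM('a) = (2 ^ DIM('a) * \<rho> powr (?n - p)) * (2 powr (?n - p)) ^ j" for j
    using \<rho>
    by (simp add: powr_mult power_mult_distrib powr_realpow[symmetric] powr_powr powr_diff powr_minus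
        field_simps powr_add[symmetric])
  moreover have "(\<lambda>j. (2 powr (?n - p)) ^ j) sums (1 / (1 - 2 powr (?n - p)))"
    using p by (intro geometric_sums) (simp add: powr_less_one)
  ultimately have S: "(\<lambda>j. ?a j * ?r j ^ DIM('a))
      sums ((2 ^ DIM('a) * \<rho> powr (?n - p)) * (1 / (1 - 2 powr (?n - p))))"
    using sums_mult by fastforce
  have cover: "\<exists>j. norm z < ?r j \<and> ?f z \<le> ?a j" if "?f z \<noteq> 0" for z :: 'a
  proof -
    have z: "\<rho> \<le> norm z" using that by (auto simp: indicator_def split: if_splits)
    obtain n :: nat where "norm z / \<rho> < 2 ^ n" using real_arch_pow[of 2] by auto
    then have ex: "\<exists>n. norm z < 2 ^ n * \<rho>" using \<rho> by (auto simp: field_simps)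
    \<comment> \<open>This least \<open>n\<close> is positive because \<rho> \<le> |z|; its
      predecessor \<open>j\<close> indexes the shell containing z.\<close>
    define n where "n = (LEAST n. norm z < 2 ^ n * \<rho>)"
    have n: "norm z < 2 ^ n * \<rho>" unfolding n_def using ex by (rule LeastI_ex)
    then obtain j where j: "n = Suc j" using z by (cases n) auto
    then have "\<not> norm z < 2 ^ j * \<rho>"
      unfolding n_def using not_less_Least by (metis lessI)
    then have "norm z powr (- p) \<le> ?a j"
      using \<rho> p by (intro powr_mono2') auto
    then show ?thesis using n j z by (intro exI[of _ j]) simp
  qed
  show ?thesis
  proof (rule integrableI_bounded)
    have "(\<integral>\<^sup>+z. ennreal (norm (?f z)) \<partial>lebesgue) = (\<integral>\<^sup>+z. ennreal (?f z) \<partial>lebesgue)"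
      by simp
    also have "\<dots> < \<infinity>"
      using nn_integral_le_sum_balls[OF cover _ _ S] \<rho> by (auto simp: top.not_eq_extremum intro: le_less_trans)
    finally show "(\<integral>\<^sup>+z. ennreal (norm (?f z)) \<partial>lebesgue) < \<infinity>" .
  qed (intro measurable_completion, measurable)
qed

text \<open>For p = n + 2s this is, up to sign, what the term |z|^2 of a test function contributes
  to the operator on a small ball. The type argument carries the space, which neither number
  determines.\<close>

definition second_moment :: "'a::euclidean_space itself \<Rightarrow> real \<Rightarrow> real \<Rightarrow> real" where
  "second_moment TYPE('a) p \<rho> =
     (LINT z|lebesgue. indicator (ball (0::'a) \<rho>) z * ((norm z)\<^sup>2 * norm z powr (- p)))"

text \<open>Now the shells \<rho> / 2^(j+1) \<le> |z| < \<rho> / 2^j shrink to the origin, and the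
  ratio is 2^(p-n-2) < 1. Taking the kernel at the inner radius costs the factor 2^p. The explicit
  power of \<rho> makes the moment vanish as \<rho> -> 0.\<close>

lemma
  fixes p \<rho> :: real
  assumes p: "0 \<le> p" "p < real DIM('a) + 2" and \<rho>: "0 < \<rho>"
  shows second_moment_integrable: "integrable lebesgue
      (\<lambda>z::'a::euclidean_space. indicator (ball 0 \<rho>) z * ((norm z)\<^sup>2 * norm z powr (- p)))" (is ?I)
    and second_moment_le: "second_moment TYPE('a) p \<rho> \<le>
      unit_ball_vol DIM('a) * 2 powr p / (1 - 2 powr (p - DIM('a) - 2)) * \<rho> powr (DIM('a) + 2 - p)"
proof -
  let ?n = "real DIM('a)"
  let ?f = "\<lambda>z::'a. indicator (ball 0 \<rho>) z * ((norm z)\<^sup>2 * norm z powr (- p))"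
  let ?a = "\<lambda>j::nat. (\<rho> / 2 ^ j)\<^sup>2 * (\<rho> / 2 ^ Suc j) powr (- p)" and ?r = "\<lambda>j::nat. \<rho> / 2 ^ j"
  let ?S = "2 powr p * \<rho> powr (?n + 2 - p) * (1 / (1 - 2 powr (p - ?n - 2)))"
  have "?a j * ?r j ^ DIM('a) = (2 powr p * \<rho> powr (?n + 2 - p)) * (2 powr (p - ?n - 2)) ^ j" for j
  proof -
    define y where "y = \<rho> / 2 ^ j"
    have y: "0 < y" using \<rho> by (simp add: y_def)
    have "?a j * ?r j ^ DIM('a) = y\<^sup>2 * (y / 2) powr (- p) * y ^ DIM('a)"
      by (simp add: y_def mult.commute)
    also have "(y / 2) powr (- p) = y powr (- p) * 2 powr p"
      using y by (simp add: powr_divide powr_minus field_simps)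
    also have "y\<^sup>2 = y powr 2" using y by simp
    also have "y ^ DIM('a) = y powr ?n" using y by (simp add: powr_realpow)
    also have "y powr 2 * (y powr (- p) * 2 powr p) * y powr ?n
        = 2 powr p * (y powr 2 * y powr (- p) * y powr ?n)"
      by (simp only: mult_ac)
    also have "y powr 2 * y powr (- p) * y powr ?n = y powr (?n + 2 - p)"
      by (simp only: powr_add[symmetric]) (simp add: algebra_simps)
    also have "y powr (?n + 2 - p) = \<rho> powr (?n + 2 - p) / (2 ^ j) powr (?n + 2 - p)"
      using \<rho> by (simp add: y_def powr_divide)
    also have "(2 ^ j) powr (?n + 2 - p) = inverse ((2 powr (p - ?n - 2)) ^ j)"
      by (simp add: powr_realpow[symmetric] powr_powr powr_minus[symmetric] algebra_simps)
    also have "2 powr p * (\<rho> powr (?n + 2 - p) / inverse ((2 powr (p - ?n - 2)) ^ j)) =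
        (2 powr p * \<rho> powr (?n + 2 - p)) * (2 powr (p - ?n - 2)) ^ j"
      by (simp add: divide_inverse)
    finally show ?thesis .
  qed
  moreover have "(\<lambda>j. (2 powr (p - ?n - 2)) ^ j) sums (1 / (1 - 2 powr (p - ?n - 2)))"
    using p by (intro geometric_sums) (simp add: powr_less_one)
  ultimately have S: "(\<lambda>j. ?a j * ?r j ^ DIM('a)) sums ?S"
    using sums_mult by fastforce
  have cover: "\<exists>j. norm z < ?r j \<and> ?f z \<le> ?a j" if "?f z \<noteq> 0" for z :: 'a
  proof -
    \<comment> \<open>The origin lies in no shell, but the integrand is zero there.\<close>
    have z: "norm z < \<rho>" "z \<noteq> 0" using that by (auto simp: indicator_def split: if_splits)
    obtain n :: nat where "\<rho> / norm z < 2 ^ n" using real_arch_pow[of 2] by auto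
    then have ex: "\<exists>n. \<rho> / 2 ^ n \<le> norm z" using z
      by (auto simp: field_simps intro!: exI[of _ n])
    define n where "n = (LEAST n. \<rho> / 2 ^ n \<le> norm z)"
    have n: "\<rho> / 2 ^ n \<le> norm z" unfolding n_def using ex by (rule LeastI_ex)
    then obtain j where j: "n = Suc j" using z by (cases n) auto
    then have *: "\<not> \<rho> / 2 ^ j \<le> norm z"
      unfolding n_def using not_less_Least by (metis lessI)
    have "(norm z)\<^sup>2 \<le> (\<rho> / 2 ^ j)\<^sup>2" using * by (intro power_mono) auto
    moreover have "norm z powr (- p) \<le> (\<rho> / 2 ^ Suc j) powr (- p)"
      using n p \<rho> unfolding j by (intro powr_mono2') auto
    ultimately have "(norm z)\<^sup>2 * norm z powr (- p) \<le> ?a j" by (intro mult_mono) auto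
    then show ?thesis using * z by (intro exI[of _ j]) simp
  qed
  have le: "(\<integral>\<^sup>+z. ennreal (?f z) \<partial>lebesgue) \<le> ennreal (unit_ball_vol DIM('a) * ?S)"
    using nn_integral_le_sum_balls[OF cover _ _ S] \<rho> by simp
  have nn: "0 \<le> unit_ball_vol DIM('a) * ?S"
    using p powr_less_one[of 2 "p - ?n - 2"] by (intro mult_nonneg_nonneg) auto
  have "second_moment TYPE('a) p \<rho> \<le> unit_ball_vol DIM('a) * ?S"
    unfolding second_moment_def using integral_real_bounded[OF nn le] .
  then show "second_moment TYPE('a) p \<rho> \<le>
      unit_ball_vol DIM('a) * 2 powr p / (1 - 2 powr (p - DIM('a) - 2)) * \<rho> powr (DIM('a) + 2 - p)"
    by (simp add: algebra_simps)
  show ?I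
  proof (rule integrableI_bounded)
    have "(\<integral>\<^sup>+z. ennreal (norm (?f z)) \<partial>lebesgue) = (\<integral>\<^sup>+z. ennreal (?f z) \<partial>lebesgue)"
      by (simp add: abs_mult)
    also have "\<dots> < \<infinity>" using le by (auto intro: le_less_trans)
    finally show "(\<integral>\<^sup>+z. ennreal (norm (?f z)) \<partial>lebesgue) < \<infinity>" .
  qed (intro measurable_completion, measurable)
qed

lemma second_moment_nonneg: "0 \<le> second_moment TYPE('a::euclidean_space) p \<rho>"
  unfolding second_moment_def by (intro Bochner_Integration.integral_nonneg) auto

lemma second_moment_tendsto_0:
  fixes p :: real
  assumes "0 \<le> p" "p < real DIM('a::euclidean_space) + 2"
  shows "(second_moment TYPE('a) p \<longlongrightarrow> 0) (at_right 0)"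
proof (rule tendsto_sandwich)
  let ?C = "unit_ball_vol DIM('a) * 2 powr p / (1 - 2 powr (p - DIM('a) - 2))"
  show "\<forall>\<^sub>F \<rho> in at_right 0. 0 \<le> second_moment TYPE('a) p \<rho>"
    by (simp add: second_moment_nonneg)
  show "\<forall>\<^sub>F \<rho> in at_right 0. second_moment TYPE('a) p \<rho> \<le> ?C * \<rho> powr (DIM('a) + 2 - p)"
    using second_moment_le[OF assms] by (auto simp: eventually_at_filter)
  have "((\<lambda>\<rho>::real. \<rho> powr (DIM('a) + 2 - p)) \<longlongrightarrow> 0 powr (DIM('a) + 2 - p)) (at_right 0)"
    using assms by (intro tendsto_powr2) (auto simp: eventually_at_filter)
  then show "((\<lambda>\<rho>. ?C * \<rho> powr (DIM('a) + 2 - p)) \<longlongrightarrow> 0) (at_right 0)"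
    by (intro tendsto_mult_right_zero) simp
qed simp

subsection \<open>The operator on functions that are quadratic near a point\<close>

text \<open>The substitution y = x + z makes kernel and domain independent of x, so that the
  operators at two points can be subtracted under one integral sign.\<close>

definition tail_operator ::
  "real \<Rightarrow> ('a::euclidean_space \<Rightarrow> real) \<Rightarrow> real \<Rightarrow> 'a \<Rightarrow> real" where
  "tail_operator p w \<delta> x =
     (LINT z|lebesgue. indicator (- ball 0 \<delta>) z * norm z powr (- p) * (w x - w (x + z)))"

lemma truncated_kernel_bound:
  fixes z :: "'a::euclidean_space"
  assumes "0 \<le> p" "0 < \<delta>"
  shows "\<bar>indicator (- ball 0 \<delta>) z * norm z powr (- p)\<bar> \<le> \<delta> powr (- p)"
proof (cases "norm z < \<delta>")
  case False
  then have "norm z powr (- p) \<le> \<delta> powr (- p)"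
    using assms by (intro powr_mono2') auto
  then show ?thesis using False by simp
qed simp

lemma kernel_measurable:
  "(\<lambda>z::'a::euclidean_space. indicator (- ball 0 \<delta>) (z - x) * norm (z - x) powr (- p))
     \<in> borel_measurable lebesgue"
proof -
  have "(\<lambda>z::'a. indicator (- ball 0 \<delta>) z * norm z powr (- p)) \<in> borel_measurable lebesgue"
    by (intro measurable_completion) measurable
  from lebesgue_measurable_isometry[OF this, of 1 "- x"] show ?thesis by simp
qed

lemma truncated_kernel_times_integrable:
  fixes w :: "'a::euclidean_space \<Rightarrow> real"
  assumes "integrable lebesgue w" "0 \<le> p" "0 < \<delta>"
  shows "integrable lebesgue (\<lambda>y. indicator (- ball 0 \<delta>) (y - x) * norm (y - x) powr (- p) * w y)"
proof (rule Bochner_Integration.integrable_bound)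
  show "integrable lebesgue (\<lambda>y. \<delta> powr (- p) * w y)" using assms by simp
  show "(\<lambda>y. indicator (- ball 0 \<delta>) (y - x) * norm (y - x) powr (- p) * w y)
    \<in> borel_measurable lebesgue"
    using assms by (intro borel_measurable_times kernel_measurable) auto
  show "AE y in lebesgue. norm (indicator (- ball 0 \<delta>) (y - x) * norm (y - x) powr (- p) * w y)
      \<le> norm (\<delta> powr (- p) * w y)"
    using truncated_kernel_bound[OF assms(2,3)]
    by (intro AE_I2) (auto simp: abs_mult intro!: mult_right_mono)
qed

text \<open>The kernel cut off at \<delta> is both integrable and bounded by \<delta>^(-p), so the
  two summands can be integrated separately. In the resulting formula w is evaluated pointwise only
  at x, and elsewhere x merely moves the kernel.\<close>

lemma
  fixes w :: "'a::euclidean_space \<Rightarrow> real"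
  assumes w: "integrable lebesgue w" and p: "real DIM('a) < p" and \<delta>: "0 < \<delta>"
  shows tail_integrable: "integrable lebesgue
      (\<lambda>z. indicator (- ball 0 \<delta>) z * norm z powr (- p) * (w x - w (x + z)))" (is ?I)
    and tail_operator_eq: "tail_operator p w \<delta> x =
      w x * (LINT z|lebesgue. indicator (- ball (0::'a) \<delta>) z * norm z powr (- p))
      - (LINT y|lebesgue. indicator (- ball 0 \<delta>) (y - x) * norm (y - x) powr (- p) * w y)" (is ?E)
proof -
  let ?k = "\<lambda>z::'a. indicator (- ball 0 \<delta>) z * norm z powr (- p)"
  let ?f = "\<lambda>y. indicator (- ball 0 \<delta>) (y - x) * norm (y - x) powr (- p) * w y"
  have f: "integrable lebesgue ?f"
    using p by (intro truncated_kernel_times_integrable w \<delta>) (simp add: less_imp_le order.trans[OF _ less_imp_le])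
  have k: "integrable lebesgue (\<lambda>z. w x * ?k z)"
    using powr_tail_integrable[OF p \<delta>] by simp
  have fx: "integrable lebesgue (\<lambda>z. ?k z * w (x + z))"
    using lebesgue_integrable_isometry[of ?f 1 x] f by simp
  have eq: "?k z * (w x - w (x + z)) = w x * ?k z - ?k z * w (x + z)" for z
    by (simp add: algebra_simps)
  show ?I unfolding eq using k fx by (rule Bochner_Integration.integrable_diff)
  show ?E unfolding tail_operator_def eq Bochner_Integration.integral_diff[OF k fx]
    using lebesgue_integral_isometry[of ?f 1 x] f by simp
qed

text \<open>By \<open>tail_operator_eq\<close> only the moving kernel needs care. It is dominated by
  \<delta>^(-p) |w|, and its cutoff can fail to converge only on the sphere of radius \<delta> about
  \<open>x0\<close>, a null set.\<close>

lemma tail_operator_tendsto: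
  fixes w :: "'a::euclidean_space \<Rightarrow> real"
  assumes w: "integrable lebesgue w" and p: "real DIM('a) < p" and \<delta>: "0 < \<delta>"
    and x: "x \<longlonglongrightarrow> x0" and wx: "(\<lambda>m. w (x m)) \<longlonglongrightarrow> w x0"
  shows "(\<lambda>m. tail_operator p w \<delta> (x m)) \<longlonglongrightarrow> tail_operator p w \<delta> x0"
proof -
  have p0: "0 \<le> p" using p by linarith
  let ?f = "\<lambda>x y. indicator (- ball 0 \<delta>) (y - x) * norm (y - x) powr (- p) * w y"
  have "(\<lambda>m. LINT y|lebesgue. ?f (x m) y) \<longlonglongrightarrow> (LINT y|lebesgue. ?f x0 y)"
  proof (rule integral_dominated_convergence[where w = "\<lambda>y. \<delta> powr (- p) * \<bar>w y\<bar>"])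
    show "AE y in lebesgue. norm (?f (x m) y) \<le> \<delta> powr (- p) * \<bar>w y\<bar>" for m
      using truncated_kernel_bound[OF p0 \<delta>]
      by (intro AE_I2) (auto simp: abs_mult intro!: mult_right_mono)
    have conv: "(\<lambda>m. ?f (x m) y) \<longlonglongrightarrow> ?f x0 y" if y: "y \<notin> sphere x0 \<delta>" for y
    proof -
      have n: "(\<lambda>m. norm (y - x m)) \<longlonglongrightarrow> norm (y - x0)"
        by (intro tendsto_intros x)
      have ne: "norm (y - x0) \<noteq> \<delta>"
        using y by (simp add: dist_norm norm_minus_commute)
      \<comment> \<open>Off the sphere the cutoff eventually equals its value for \<open>x0\<close>,
        which leaves only the power of the norm to converge.\<close>
      have ind: "\<forall>\<^sub>F m in sequentially.
          indicator (- ball 0 \<delta>) (y - x0) * norm (y - x m) powr (- p) * w y = ?f (x m) y"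
      proof (cases "norm (y - x0) < \<delta>")
        case True
        then show ?thesis
          by (intro eventually_mono[OF order_tendstoD(2)[OF n True]]) (auto simp: indicator_def)
      next
        case False
        then have gt: "\<delta> < norm (y - x0)" using ne by simp
        show ?thesis
          using False by (intro eventually_mono[OF order_tendstoD(1)[OF n gt]]) (auto simp: indicator_def)
      qed
      have "(\<lambda>m. indicator (- ball 0 \<delta>) (y - x0) * norm (y - x m) powr (- p) * w y) \<longlonglongrightarrow> ?f x0 y"
      \<comment> \<open>The power is singular at y = \<open>x0\<close>, but there the cutoff is
        zero.\<close>
      proof (cases "y = x0")
        case True
        then show ?thesis using \<delta> by simp
      next
        case False
        then show ?thesis by (intro tendsto_intros n) simp
      qed
      then show ?thesis using ind by (rule Lim_transform_eventually)
    qed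
    have "sphere x0 \<delta> \<in> null_sets lebesgue"
      using negligible_sphere negligible_iff_null_sets by blast
    then show "AE y in lebesgue. (\<lambda>m. ?f (x m) y) \<longlonglongrightarrow> ?f x0 y"
      by (rule AE_I') (use conv in blast)
    show "?f x0 \<in> borel_measurable lebesgue" "\<And>m. ?f (x m) \<in> borel_measurable lebesgue"
      using w by (auto intro!: borel_measurable_times kernel_measurable)
    show "integrable lebesgue (\<lambda>y. \<delta> powr (- p) * \<bar>w y\<bar>)" using w by simp
  qed
  then show ?thesis
    unfolding tail_operator_eq[OF w p \<delta>] by (intro tendsto_intros wx)
qed

text \<open>The linear term is odd and integrates to zero over the symmetric annulus. On the full
  ball it need not be absolutely integrable, since p may exceed n + 1; hence the inner ball is
  removed.\<close>

lemma
  fixes b :: "'a::euclidean_space"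
  assumes p: "real DIM('a) < p" "p < real DIM('a) + 2" and \<delta>: "0 < \<delta>" "\<delta> \<le> \<rho>"
  shows annulus_quadratic_integrable: "integrable lebesgue
      (\<lambda>z. indicator (ball 0 \<rho> - ball 0 \<delta>) z * norm z powr (- p) * (b \<bullet> z + c * (norm z)\<^sup>2))" (is ?I)
    and annulus_quadratic_integral: "(LINT z|lebesgue.
        indicator (ball 0 \<rho> - ball 0 \<delta>) z * norm z powr (- p) * (b \<bullet> z + c * (norm z)\<^sup>2))
      = c * (second_moment TYPE('a) p \<rho> - second_moment TYPE('a) p \<delta>)" (is ?E)
proof -
  have p0: "0 \<le> p" using p by linarith
  have \<rho>: "0 < \<rho>" using \<delta> by simp
  let ?m = "\<lambda>\<rho> z::'a. indicator (ball 0 \<rho>) z * ((norm z)\<^sup>2 * norm z powr (- p))"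
  let ?o = "\<lambda>z::'a. indicator (ball 0 \<rho> - ball 0 \<delta>) z * norm z powr (- p) * (b \<bullet> z)"
  have eq: "indicator (ball 0 \<rho> - ball 0 \<delta>) z * norm z powr (- p) * (b \<bullet> z + c * (norm z)\<^sup>2)
      = ?o z + c * (?m \<rho> z - ?m \<delta> z)" for z
    using \<delta> by (auto simp: indicator_def algebra_simps)
  have om: "?o \<in> borel_measurable lebesgue"
    by (intro measurable_completion) measurable
  have o: "integrable lebesgue ?o"
  proof (rule Bochner_Integration.integrable_bound)
    show "integrable lebesgue
        (\<lambda>z::'a. (norm b * \<rho>) * (indicator (- ball 0 \<delta>) z * norm z powr (- p)))"
      using powr_tail_integrable[OF p(1) \<delta>(1)] by simp
    have "\<bar>?o z\<bar> \<le> (norm b * \<rho>) * (indicator (- ball 0 \<delta>) z * norm z powr (- p))" for z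
    proof (cases "z \<in> ball 0 \<rho> - ball 0 \<delta>")
      case True
      have "\<bar>b \<bullet> z\<bar> \<le> norm b * norm z" by (rule Cauchy_Schwarz_ineq2)
      also have "\<dots> \<le> norm b * \<rho>" using True by (intro mult_left_mono) auto
      finally have "norm z powr (- p) * \<bar>b \<bullet> z\<bar> \<le> norm z powr (- p) * (norm b * \<rho>)"
        by (intro mult_left_mono) auto
      then show ?thesis using True by (simp add: abs_mult mult_ac)
    qed (use \<rho> in auto)
    then show "AE z in lebesgue. norm (?o z)
        \<le> norm ((norm b * \<rho>) * (indicator (- ball 0 \<delta>) z * norm z powr (- p)))"
      using \<rho> by (intro AE_I2) (auto simp: abs_mult)
  qed (rule om)
  have m: "integrable lebesgue (?m \<rho>)" "integrable lebesgue (?m \<delta>)"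
    using second_moment_integrable[OF p0 p(2)] \<rho> \<delta> by auto
  have "integral\<^sup>L lebesgue ?o = - integral\<^sup>L lebesgue ?o"
    using lebesgue_integral_isometry[of ?o "-1" 0] om by (simp add: indicator_def)
  then have o0: "integral\<^sup>L lebesgue ?o = 0" by simp
  show ?I unfolding eq using o m by simp
  show ?E unfolding eq using o m o0
    by (simp add: second_moment_def)
qed

text \<open>For \<epsilon> < \<delta> the truncated integral is computed exactly: the tail outside
  radius \<delta> minus an annulus integral in which \<open>b\<close> has disappeared. Only the
  second moment at \<epsilon> still depends on \<epsilon>, and it tends to 0. Thus the limit exists,
  without which \<open>Lim\<close> would say nothing.\<close>

lemma frac_laplacian_quadratic_patch:
  fixes w :: "real^'n \<Rightarrow> real"
  assumes w: "integrable lebesgue w" and s: "0 < s" "s < 1" and \<delta>: "0 < \<delta>"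
    and p: "p = real CARD('n) + 2 * s"
  shows "frac_laplacian s
      (\<lambda>y. if y \<in> ball x \<delta> then w x + b \<bullet> (y - x) + c * (norm (y - x))\<^sup>2 else w y) x
    = tail_operator p w \<delta> x - c * second_moment TYPE(real^'n) p \<delta>"
proof -
  let ?W = "\<lambda>y. if y \<in> ball x \<delta> then w x + b \<bullet> (y - x) + c * (norm (y - x))\<^sup>2 else w y"
  let ?M = "second_moment TYPE(real^'n) p"
  have pp: "real DIM(real^'n) < p" "p < real DIM(real^'n) + 2" "0 \<le> p" using s p by auto
  have trunc: "(LINT y : - ball x \<epsilon> | lebesgue. (?W x - ?W y) / norm (x - y) powr p)
      = tail_operator p w \<delta> x - c * (?M \<delta> - ?M \<epsilon>)" if \<epsilon>: "0 < \<epsilon>" "\<epsilon> < \<delta>" for \<epsilon>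
  proof -
    let ?f = "\<lambda>y. indicator (- ball x \<epsilon>) y * ((?W x - ?W y) / norm (x - y) powr p)"
    have Wm: "?W \<in> borel_measurable lebesgue"
    proof (intro measurable_If_set)
      show "(\<lambda>y. w x + b \<bullet> (y - x) + c * (norm (y - x))\<^sup>2) \<in> borel_measurable lebesgue"
        by (intro measurable_completion) measurable
    qed (use w in auto)
    have "(\<lambda>y. indicator (- ball x \<epsilon>) y / norm (x - y) powr p) \<in> borel_measurable lebesgue"
      by (intro measurable_completion) measurable
    then have "(\<lambda>y. (indicator (- ball x \<epsilon>) y / norm (x - y) powr p) * (?W x - ?W y))
        \<in> borel_measurable lebesgue"
      using Wm by (intro borel_measurable_times borel_measurable_diff) auto
    then have fm: "?f \<in> borel_measurable lebesgue"
      by (simp add: mult.commute)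
    have eq: "?f (x + z) = indicator (- ball 0 \<delta>) z * norm z powr (- p) * (w x - w (x + z))
        - indicator (ball 0 \<delta> - ball 0 \<epsilon>) z * norm z powr (- p) * (b \<bullet> z + c * (norm z)\<^sup>2)" for z
      using \<epsilon> \<delta> by (auto simp: indicator_def dist_norm powr_minus divide_inverse algebra_simps)
    have "(LINT y : - ball x \<epsilon> | lebesgue. (?W x - ?W y) / norm (x - y) powr p)
        = integral\<^sup>L lebesgue ?f"
      by (simp add: set_lebesgue_integral_def)
    also have "\<dots> = (LINT z|lebesgue. ?f (x + z))"
      by (rule lebesgue_integral_isometry[OF fm abs_one, of x, unfolded scaleR_one, symmetric])
    also have "\<dots> = tail_operator p w \<delta> x - c * (?M \<delta> - ?M \<epsilon>)"
      unfolding eq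
      using tail_integrable[OF w pp(1) \<delta>, of x]
        annulus_quadratic_integrable[OF pp(1,2), of \<epsilon> \<delta> b c]
        annulus_quadratic_integral[OF pp(1,2), of \<epsilon> \<delta> b c] \<epsilon>
      by (simp add: tail_operator_def)
    finally show ?thesis .
  qed
  have "((\<lambda>\<epsilon>. tail_operator p w \<delta> x - c * (?M \<delta> - ?M \<epsilon>))
      \<longlongrightarrow> tail_operator p w \<delta> x - c * (?M \<delta> - 0)) (at_right 0)"
    by (intro tendsto_intros second_moment_tendsto_0 pp)
  then have "((\<lambda>\<epsilon>. LINT y : - ball x \<epsilon> | lebesgue. (?W x - ?W y) / norm (x - y) powr p)
      \<longlongrightarrow> tail_operator p w \<delta> x - c * (?M \<delta> - 0)) (at_right 0)"
  proof (rule Lim_transform_eventually)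
    show "\<forall>\<^sub>F \<epsilon> in at_right 0. tail_operator p w \<delta> x - c * (?M \<delta> - ?M \<epsilon>)
        = (LINT y : - ball x \<epsilon> | lebesgue. (?W x - ?W y) / norm (x - y) powr p)"
      using \<delta> by (intro eventually_at_rightI[of 0 \<delta>]) (simp_all only: trunc greaterThanLessThan_iff)
  qed
  then have "Lim (at_right 0) (\<lambda>\<epsilon>. LINT y : - ball x \<epsilon> | lebesgue. (?W x - ?W y) / norm (x - y) powr p)
      = tail_operator p w \<delta> x - c * (?M \<delta> - 0)"
    by (intro tendsto_Lim) simp_all
  then show ?thesis unfolding frac_laplacian_def p by simp
qed

subsection \<open>Uniqueness of the right-hand side\<close>

lemma C2_on_quadratic:
  fixes x b :: "real^'n"
  shows "C2_on UNIV (\<lambda>y. a + b \<bullet> (y - x) + c * (norm (y - x))\<^sup>2)"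
  unfolding C2_on_def
proof (intro conjI exI ballI)
  fix y :: "real^'n"
  \<comment> \<open>The witnesses left open above are fixed here: gradient b + 2c (y - x), and below
    the Hessian 2c times the identity.\<close>
  show "((\<lambda>y. a + b \<bullet> (y - x) + c * (norm (y - x))\<^sup>2) has_derivative
      (\<lambda>h. (b + (2 * c) *\<^sub>R (y - x)) \<bullet> h)) (at y)"
    unfolding power2_norm_eq_inner
    by (rule has_derivative_eq_rhs, (rule derivative_intros)+)
       (auto simp: fun_eq_iff inner_simps inner_commute algebra_simps)
  have "mat (2 * c) *v h = (2 * c) *\<^sub>R h" for h :: "real^'n"
    by (simp add: vec_eq_iff matrix_vector_mult_def mat_def if_distrib[of "\<lambda>x. x * _"] cong: if_cong)
  then show "((\<lambda>y. b + (2 * c) *\<^sub>R (y - x)) has_derivative (\<lambda>h. mat (2 * c) *v h)) (at y)"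
    by (auto intro!: derivative_eq_intros)
qed auto

text \<open>Quadratics are smooth on the whole space, so they are admissible on the ball of radius
  \<delta> as soon as the one-sided inequality holds there. The operator on the glued function is
  then known explicitly.\<close>

lemma
  fixes w :: "real^'n \<Rightarrow> real"
  assumes w: "integrable lebesgue w" and s: "0 < s" "s < 1" and \<delta>: "0 < \<delta>"
    and p: "p = real CARD('n) + 2 * s" and sub: "ball x \<delta> \<subseteq> \<Omega>"
  shows subsolution_quadratic_test:
      "\<lbrakk>viscosity_subsolution s \<Omega> w g;
        \<And>y. y \<in> ball x \<delta> \<Longrightarrow> w y \<le> w x + b \<bullet> (y - x) + c * (norm (y - x))\<^sup>2\<rbrakk>
       \<Longrightarrow> tail_operator p w \<delta> x - c * second_moment TYPE(real^'n) p \<delta> \<le> g x"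
    and supersolution_quadratic_test:
      "\<lbrakk>viscosity_supersolution s \<Omega> w g;
        \<And>y. y \<in> ball x \<delta> \<Longrightarrow> w x + b \<bullet> (y - x) + c * (norm (y - x))\<^sup>2 \<le> w y\<rbrakk>
       \<Longrightarrow> g x \<le> tail_operator p w \<delta> x - c * second_moment TYPE(real^'n) p \<delta>"
proof -
  let ?\<phi> = "\<lambda>y. w x + b \<bullet> (y - x) + c * (norm (y - x))\<^sup>2"
  have x: "x \<in> \<Omega>" using sub \<delta> by auto
  have U: "\<exists>U. closure (ball x \<delta>) \<subseteq> U \<and> C2_on U ?\<phi>"
    using C2_on_quadratic by blast
  note L = frac_laplacian_quadratic_patch[OF w s \<delta> p, of x b c]
  {
    assume v: "viscosity_subsolution s \<Omega> w g" and t: "\<And>y. y \<in> ball x \<delta> \<Longrightarrow> w y \<le> ?\<phi> y"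
    have "touches_above \<Omega> w x (ball x \<delta>) ?\<phi>"
      unfolding touches_above_def using U \<delta> sub t by auto
    then have "frac_laplacian s (\<lambda>y. if y \<in> ball x \<delta> then ?\<phi> y else w y) x \<le> g x"
      using v x unfolding viscosity_subsolution_def by blast
    then show "tail_operator p w \<delta> x - c * second_moment TYPE(real^'n) p \<delta> \<le> g x"
      unfolding L .
  }
  {
    assume v: "viscosity_supersolution s \<Omega> w g" and t: "\<And>y. y \<in> ball x \<delta> \<Longrightarrow> ?\<phi> y \<le> w y"
    have "touches_below \<Omega> w x (ball x \<delta>) ?\<phi>"
      unfolding touches_below_def using U \<delta> sub t by auto
    then have "g x \<le> frac_laplacian s (\<lambda>y. if y \<in> ball x \<delta> then ?\<phi> y else w y) x"
      using v x unfolding viscosity_supersolution_def by blast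
    then show "g x \<le> tail_operator p w \<delta> x - c * second_moment TYPE(real^'n) p \<delta>"
      unfolding L .
  }
qed

text \<open>The two tails at radius \<delta> differ from those at \<rho> by an integral over the
  annulus, where \<open>le\<close> applies under the kernel. By symmetry the bound is free of
  \<open>b\<close>, and it stays finite as \<delta> -> 0 with \<rho> fixed.\<close>

lemma tail_operator_diff_le:
  fixes w :: "'a::euclidean_space \<Rightarrow> real"
  assumes w: "integrable lebesgue w" and p: "real DIM('a) < p" "p < real DIM('a) + 2"
    and \<delta>: "0 < \<delta>" "\<delta> \<le> \<rho>"
    and le: "\<And>z. norm z < \<rho> \<Longrightarrow> (w y - w (y + z)) - (w x - w (x + z)) \<le> b \<bullet> z + c * (norm z)\<^sup>2"
  shows "tail_operator p w \<delta> y - tail_operator p w \<delta> x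
    \<le> tail_operator p w \<rho> y - tail_operator p w \<rho> x
       + c * (second_moment TYPE('a) p \<rho> - second_moment TYPE('a) p \<delta>)"
proof -
  have \<rho>: "0 < \<rho>" using \<delta> by simp
  let ?t = "\<lambda>\<delta> x z. indicator (- ball 0 \<delta>) z * norm z powr (- p) * (w x - w (x + z))"
  let ?q = "\<lambda>z. indicator (ball 0 \<rho> - ball 0 \<delta>) z * norm z powr (- p) * (b \<bullet> z + c * (norm z)\<^sup>2)"
  have t: "integrable lebesgue (?t d v)" if "0 < d" for d v
    using tail_integrable[OF w p(1) that] .
  have q: "integrable lebesgue ?q"
    by (rule annulus_quadratic_integrable[OF p \<delta>])
  have "(LINT z|lebesgue. ?t \<delta> y z - ?t \<delta> x z) \<le> (LINT z|lebesgue. ?t \<rho> y z - ?t \<rho> x z + ?q z)"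
  proof (rule integral_mono)
    fix z :: 'a
    show "?t \<delta> y z - ?t \<delta> x z \<le> ?t \<rho> y z - ?t \<rho> x z + ?q z"
    proof (cases "z \<in> ball 0 \<rho> - ball 0 \<delta>")
      case True
      then have "norm z powr (- p) * ((w y - w (y + z)) - (w x - w (x + z)))
          \<le> norm z powr (- p) * (b \<bullet> z + c * (norm z)\<^sup>2)"
        by (intro mult_left_mono le) auto
      then show ?thesis using True by (simp add: right_diff_distrib)
    qed (use \<delta> in \<open>auto simp: indicator_def\<close>)
  qed (intro Bochner_Integration.integrable_add Bochner_Integration.integrable_diff t q \<delta>(1) \<rho>)+
  then show ?thesis
    unfolding tail_operator_def using t[OF \<delta>(1)] t[OF \<rho>] q annulus_quadratic_integral[OF p \<delta>, of b c]
    by simp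
qed

text \<open>Comparison with the pair (x0, x0) bounds both penalties by w x - w y. Boundedness of w
  gives x - y -> 0; uniform continuity then gives w x - w y -> 0, which forces x -> x0 through the
  \<kappa>-penalty. \<open>Suc m\<close> keeps every weight positive.\<close>

lemma doubling_maximum:
  fixes w :: "'a::euclidean_space \<Rightarrow> real"
  assumes w: "continuous_on (cball x0 r) w" and r: "0 < r" and \<kappa>: "0 < \<kappa>"
  obtains x y :: "nat \<Rightarrow> 'a" where
    "\<And>m. x m \<in> cball x0 r" "\<And>m. y m \<in> cball x0 r"
    "\<And>m a b. \<lbrakk>a \<in> cball x0 r; b \<in> cball x0 r\<rbrakk> \<Longrightarrow>
      w a - w b - real (Suc m) * (norm (a - b))\<^sup>2 - \<kappa> * (norm (a - x0))\<^sup>2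
      \<le> w (x m) - w (y m) - real (Suc m) * (norm (x m - y m))\<^sup>2 - \<kappa> * (norm (x m - x0))\<^sup>2"
    "x \<longlonglongrightarrow> x0" "y \<longlonglongrightarrow> x0"
proof -
  let ?B = "cball x0 r"
  define \<Phi> where "\<Phi> m v = w (fst v) - w (snd v) - real (Suc m) * (norm (fst v - snd v))\<^sup>2
      - \<kappa> * (norm (fst v - x0))\<^sup>2" for m v
  have "\<exists>v\<in>?B \<times> ?B. \<forall>v'\<in>?B \<times> ?B. \<Phi> m v' \<le> \<Phi> m v" for m
  proof (rule continuous_attains_sup)
    show "continuous_on (?B \<times> ?B) (\<Phi> m)" unfolding \<Phi>_def
      by (intro continuous_intros continuous_on_compose2[OF w]) auto
  qed (use r in \<open>auto intro!: compact_Times\<close>)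
  then obtain v where v: "\<And>m. v m \<in> ?B \<times> ?B"
      "\<And>m v'. v' \<in> ?B \<times> ?B \<Longrightarrow> \<Phi> m v' \<le> \<Phi> m (v m)"
    by metis
  define x y where "x m = fst (v m)" and "y m = snd (v m)" for m
  have xy: "x m \<in> ?B" "y m \<in> ?B" for m
    using v(1)[of m] by (auto simp: x_def y_def mem_Times_iff)
  have max: "\<Phi> m (a, b) \<le> \<Phi> m (x m, y m)" if "a \<in> ?B" "b \<in> ?B" for m a b
    using v(2)[of "(a, b)" m] that by (simp add: x_def y_def)
  have pen: "real (Suc m) * (norm (x m - y m))\<^sup>2 + \<kappa> * (norm (x m - x0))\<^sup>2 \<le> w (x m) - w (y m)" for m
    using max[of x0 x0 m] r by (simp add: \<Phi>_def)
  have "compact (w ` ?B)" using w by (intro compact_continuous_image) auto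
  then obtain C where C: "\<And>v. v \<in> ?B \<Longrightarrow> \<bar>w v\<bar> \<le> C"
    using compact_imp_bounded bounded_iff by (metis image_eqI real_norm_def)
  have "(norm (x m - y m))\<^sup>2 \<le> 2 * C * inverse (real (Suc m))" for m
  proof -
    have "real (Suc m) * (norm (x m - y m))\<^sup>2 \<le> real (Suc m) * (norm (x m - y m))\<^sup>2 + \<kappa> * (norm (x m - x0))\<^sup>2"
      using \<kappa> by simp
    also have "\<dots> \<le> 2 * C" using pen[of m] C[OF xy(1)[of m]] C[OF xy(2)[of m]] by linarith
    finally show ?thesis by (simp add: field_simps del: of_nat_Suc)
  qed
  then have "(\<lambda>m. (norm (x m - y m))\<^sup>2) \<longlonglongrightarrow> 0"
    by (intro tendsto_sandwich[OF _ _ tendsto_const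
          tendsto_mult_right_zero[OF LIMSEQ_inverse_real_of_nat, of "2 * C"]] always_eventually) auto
  from tendsto_real_sqrt[OF this] have d: "(\<lambda>m. x m - y m) \<longlonglongrightarrow> 0"
    by (simp add: tendsto_norm_zero_iff)
  have "uniformly_continuous_on ?B w"
    using w by (intro compact_uniformly_continuous) auto
  then have "(\<lambda>m. dist (w (x m)) (w (y m))) \<longlonglongrightarrow> 0"
    using xy d unfolding uniformly_continuous_on_sequentially
    by (auto simp: dist_norm tendsto_norm_zero_iff)
  then have wd: "(\<lambda>m. w (x m) - w (y m)) \<longlonglongrightarrow> 0"
    by (simp add: dist_real_def tendsto_rabs_zero_iff)
  have "(norm (x m - x0))\<^sup>2 \<le> inverse \<kappa> * (w (x m) - w (y m))" for m
  proof -
    have "\<kappa> * (norm (x m - x0))\<^sup>2 \<le> real (Suc m) * (norm (x m - y m))\<^sup>2 + \<kappa> * (norm (x m - x0))\<^sup>2"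
      by simp
    also note pen[of m]
    finally show ?thesis using \<kappa> by (simp add: field_simps)
  qed
  then have "(\<lambda>m. (norm (x m - x0))\<^sup>2) \<longlonglongrightarrow> 0"
    by (intro tendsto_sandwich[OF _ _ tendsto_const tendsto_mult_right_zero[OF wd, of "inverse \<kappa>"]]
        always_eventually) auto
  from tendsto_real_sqrt[OF this] have "(\<lambda>m. x m - x0) \<longlonglongrightarrow> 0"
    by (simp add: tendsto_norm_zero_iff)
  then have x: "x \<longlonglongrightarrow> x0" by (simp add: LIM_zero_iff)
  have y: "y \<longlonglongrightarrow> x0" using tendsto_diff[OF x d] by simp
  show thesis
    by (rule that[of x y, OF xy _ x y]) (use max in \<open>auto simp: \<Phi>_def\<close>)
qed

lemma viscosity_supersolution_le_subsolution:
  fixes w g h :: "real^'n \<Rightarrow> real"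
  assumes s: "0 < s" "s < 1" and w: "integrable lebesgue w" and \<Omega>: "open \<Omega>"
    and cw: "continuous_on \<Omega> w" and cg: "continuous_on \<Omega> g" and ch: "continuous_on \<Omega> h"
    and sub: "viscosity_subsolution s \<Omega> w g" and super: "viscosity_supersolution s \<Omega> w h"
    and x0: "x0 \<in> \<Omega>"
  shows "h x0 \<le> g x0"
proof -
  define p where "p = real CARD('n) + 2 * s"
  have p: "real DIM(real^'n) < p" "p < real DIM(real^'n) + 2" "0 \<le> p" using s by (auto simp: p_def)
  let ?M = "second_moment TYPE(real^'n) p"
  let ?T = "tail_operator p w"
  obtain r where r: "0 < r" "cball x0 r \<subseteq> \<Omega>" using \<Omega> x0 open_contains_cball by blast
  \<comment> \<open>Half the radius: points within \<rho> of \<open>x0\<close> shifted by less than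
    \<rho> stay in the ball on which the maximum was taken.\<close>
  define \<rho> where "\<rho> = r / 2"
  have \<rho>: "0 < \<rho>" using r by (simp add: \<rho>_def)
  have near: "v + z \<in> cball x0 r" if "v \<in> ball x0 \<rho>" "norm z < \<rho>" for v z
    using that dist_triangle[of x0 "v + z" v] by (simp add: \<rho>_def dist_norm)
  have expand: "(norm (v - c))\<^sup>2 = (norm (a - c))\<^sup>2 + 2 * ((a - c) \<bullet> (v - a)) + (norm (v - a))\<^sup>2"
    for a c v :: "real^'n"
    by (simp add: power2_norm_eq_inner inner_simps inner_commute)
  \<comment> \<open>The radius \<rho> was chosen before \<kappa>, so this bound yields the claim as
    \<kappa> -> 0.\<close>
  have "h x0 - g x0 \<le> \<kappa> * ?M \<rho>" if \<kappa>: "0 < \<kappa>" for \<kappa>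
  proof -
    obtain x y :: "nat \<Rightarrow> real^'n" where in_B: "\<And>m. x m \<in> cball x0 r" "\<And>m. y m \<in> cball x0 r"
      and max: "\<And>m a b. \<lbrakk>a \<in> cball x0 r; b \<in> cball x0 r\<rbrakk> \<Longrightarrow>
        w a - w b - real (Suc m) * (norm (a - b))\<^sup>2 - \<kappa> * (norm (a - x0))\<^sup>2
        \<le> w (x m) - w (y m) - real (Suc m) * (norm (x m - y m))\<^sup>2 - \<kappa> * (norm (x m - x0))\<^sup>2"
      and lim: "x \<longlonglongrightarrow> x0" "y \<longlonglongrightarrow> x0"
      using doubling_maximum[OF continuous_on_subset[OF cw r(2)] r(1) \<kappa>] by blast
    have key: "h (y m) - g (x m) \<le> ?T \<rho> (y m) - ?T \<rho> (x m) + \<kappa> * ?M \<rho>"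
      if m: "x m \<in> ball x0 \<rho>" "y m \<in> ball x0 \<rho>" for m
    proof -
      define q where "q = real (Suc m)"
      define X where "X = x m"
      define Y where "Y = y m"
      have max': "w a - w b - q * (norm (a - b))\<^sup>2 - \<kappa> * (norm (a - x0))\<^sup>2
        \<le> w X - w Y - q * (norm (X - Y))\<^sup>2 - \<kappa> * (norm (X - x0))\<^sup>2"
        if "a \<in> cball x0 r" "b \<in> cball x0 r" for a b
        using max[OF that] unfolding q_def X_def Y_def .
      have XY: "X \<in> ball x0 \<rho>" "Y \<in> ball x0 \<rho>" "X \<in> cball x0 r" "Y \<in> cball x0 r"
        using m in_B by (auto simp: X_def Y_def)
      \<comment> \<open>The two viscosity inequalities cost (q + \<kappa>) and q times the moment at
        \<delta>; the annulus comparison returns \<kappa> times it, which leaves 2q.\<close>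
      have step: "h Y - g X \<le> ?T \<rho> Y - ?T \<rho> X + \<kappa> * ?M \<rho> + 2 * q * ?M \<delta>"
        if \<delta>: "0 < \<delta>" "\<delta> \<le> \<rho>" for \<delta>
      proof -
        have ball: "v \<in> cball x0 r" if "v \<in> ball u \<delta>" "u \<in> ball x0 \<rho>" for u v
          using near[OF that(2), of "v - u"] that(1) \<delta> by (simp add: dist_norm norm_minus_commute)
        have ball_sub: "ball u \<delta> \<subseteq> \<Omega>" if "u \<in> ball x0 \<rho>" for u
          using ball[OF _ that] r(2) by blast
        \<comment> \<open>Freezing b = Y in \<open>max'\<close> makes both penalties quadratics in
          a, hence the coefficient q + \<kappa>.\<close>
        have "?T \<delta> X - (q + \<kappa>) * ?M \<delta> \<le> g X"
        proof (rule subsolution_quadratic_test[OF w s \<delta>(1) p_def ball_sub[OF XY(1)] sub])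
          fix v assume v: "v \<in> ball X \<delta>"
          have "w v \<le> w X + 2 * q * ((X - Y) \<bullet> (v - X)) + 2 * \<kappa> * ((X - x0) \<bullet> (v - X))
              + (q + \<kappa>) * (norm (v - X))\<^sup>2"
            using max'[OF ball[OF v XY(1)] XY(4)] expand[of v Y X] expand[of v x0 X]
            by (simp add: distrib_left distrib_right)
          then show "w v \<le> w X + ((2 * q) *\<^sub>R (X - Y) + (2 * \<kappa>) *\<^sub>R (X - x0)) \<bullet> (v - X)
              + (q + \<kappa>) * (norm (v - X))\<^sup>2"
            by (simp add: inner_add_left)
        qed
        \<comment> \<open>Freezing a = X leaves the \<kappa>-penalty constant, so the coefficient is
          -q.\<close>
        moreover have "h Y \<le> ?T \<delta> Y - (- q) * ?M \<delta>"
        proof (rule supersolution_quadratic_test[OF w s \<delta>(1) p_def ball_sub[OF XY(2)] super])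
          fix v assume v: "v \<in> ball Y \<delta>"
          have "(norm (X - v))\<^sup>2 = (norm (X - Y))\<^sup>2 - 2 * ((X - Y) \<bullet> (v - Y)) + (norm (v - Y))\<^sup>2"
            using expand[of v X Y] by (simp add: norm_minus_commute inner_diff_left)
          then have "w Y + 2 * q * ((X - Y) \<bullet> (v - Y)) + - q * (norm (v - Y))\<^sup>2 \<le> w v"
            using max'[OF XY(3) ball[OF v XY(2)]]
            by (simp add: distrib_left distrib_right right_diff_distrib)
          then show "w Y + ((2 * q) *\<^sub>R (X - Y)) \<bullet> (v - Y) + - q * (norm (v - Y))\<^sup>2 \<le> w v"
            by simp
        qed
        \<comment> \<open>Shifting both points by the same z leaves a - b unchanged. The coupling
          penalty therefore cancels, and the bound does not grow with q.\<close>
        moreover have "?T \<delta> Y - ?T \<delta> X \<le> ?T \<rho> Y - ?T \<rho> X + \<kappa> * (?M \<rho> - ?M \<delta>)"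
        proof (rule tail_operator_diff_le[OF w p(1,2) \<delta>])
          fix z :: "real^'n" assume z: "norm z < \<rho>"
          have "(w Y - w (Y + z)) - (w X - w (X + z)) \<le> 2 * \<kappa> * ((X - x0) \<bullet> z) + \<kappa> * (norm z)\<^sup>2"
            using max'[OF near[OF XY(1) z] near[OF XY(2) z]] expand[of "X + z" x0 X]
            by (simp add: distrib_left distrib_right)
          then show "(w Y - w (Y + z)) - (w X - w (X + z))
              \<le> ((2 * \<kappa>) *\<^sub>R (X - x0)) \<bullet> z + \<kappa> * (norm z)\<^sup>2"
            by simp
        qed
        ultimately show ?thesis by (simp add: algebra_simps)
      qed
      \<comment> \<open>Here m, and with it q, is fixed while \<delta> -> 0, so the large factor q
        does no harm.\<close>
      have "((\<lambda>\<delta>. ?T \<rho> Y - ?T \<rho> X + \<kappa> * ?M \<rho> + 2 * q * ?M \<delta>)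
          \<longlongrightarrow> ?T \<rho> Y - ?T \<rho> X + \<kappa> * ?M \<rho> + 2 * q * 0) (at_right 0)"
        by (intro tendsto_intros second_moment_tendsto_0 p)
      then have "h Y - g X \<le> ?T \<rho> Y - ?T \<rho> X + \<kappa> * ?M \<rho> + 2 * q * 0"
        by (rule tendsto_lowerbound) (use \<rho> step in \<open>auto intro!: eventually_at_rightI[of 0 \<rho>]\<close>)
      then show ?thesis by (simp add: X_def Y_def)
    qed
    have at: "(\<lambda>m. f (v m)) \<longlonglongrightarrow> f x0" if "continuous_on \<Omega> f" "v \<longlonglongrightarrow> x0" for f :: "real^'n \<Rightarrow> real" and v
      using that \<Omega> x0 by (metis continuous_on_eq_continuous_at isCont_tendsto_compose)
    \<comment> \<open>As m grows both points tend to \<open>x0\<close>, and the tails at the fixed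
      radius \<rho> cancel in the limit.\<close>
    have "(\<lambda>m. ?T \<rho> (y m) - ?T \<rho> (x m) + \<kappa> * ?M \<rho>) \<longlonglongrightarrow> ?T \<rho> x0 - ?T \<rho> x0 + \<kappa> * ?M \<rho>"
      by (intro tendsto_intros tail_operator_tendsto[OF w p(1) \<rho>] at[OF cw] lim)
    moreover have "(\<lambda>m. h (y m) - g (x m)) \<longlonglongrightarrow> h x0 - g x0"
      by (intro tendsto_intros at[OF ch] at[OF cg] lim)
    moreover have "\<forall>\<^sub>F m in sequentially. x m \<in> ball x0 \<rho>" "\<forall>\<^sub>F m in sequentially. y m \<in> ball x0 \<rho>"
      using topological_tendstoD[OF lim(1) open_ball] topological_tendstoD[OF lim(2) open_ball] \<rho>
      by (simp_all only: centre_in_ball)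
    then have "\<forall>\<^sub>F m in sequentially. h (y m) - g (x m) \<le> ?T \<rho> (y m) - ?T \<rho> (x m) + \<kappa> * ?M \<rho>"
      by eventually_elim (rule key)
    ultimately have "h x0 - g x0 \<le> ?T \<rho> x0 - ?T \<rho> x0 + \<kappa> * ?M \<rho>"
      by (rule tendsto_le[OF sequentially_bot])
    then show ?thesis by simp
  qed
  moreover have "((\<lambda>\<kappa>. \<kappa> * ?M \<rho>) \<longlongrightarrow> 0 * ?M \<rho>) (at_right 0)"
    by (intro tendsto_intros)
  ultimately have "h x0 - g x0 \<le> 0 * ?M \<rho>"
    by (intro tendsto_lowerbound[of "\<lambda>\<kappa>. \<kappa> * ?M \<rho>"]) (auto simp: eventually_at_filter)
  then show ?thesis by simp
qed

lemma viscosity_solution_unique_rhs: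
  fixes w g h :: "real^'n \<Rightarrow> real"
  assumes "0 < s" "s < 1" "integrable lebesgue w" "open \<Omega>"
    and "viscosity_solution s \<Omega> w g" "viscosity_solution s \<Omega> w h" "x \<in> \<Omega>"
  shows "g x = h x"
proof (rule antisym)
  note v = assms(5,6)[unfolded viscosity_solution_def]
  show "g x \<le> h x"
    by (rule viscosity_supersolution_le_subsolution[OF assms(1-4)]) (use v assms(7) in blast)+
  show "h x \<le> g x"
    by (rule viscosity_supersolution_le_subsolution[OF assms(1-4)]) (use v assms(7) in blast)+
qed

subsection \<open>Limits of polynomials\<close>

text \<open>Gaussian elimination: evaluating at a point where one function does not vanish determines the
  coefficient of that function. The functions need not be independent.\<close>

lemma limit_in_span:
  fixes e :: "'i \<Rightarrow> 'x \<Rightarrow> real" and q :: "'t \<Rightarrow> 'x \<Rightarrow> real"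
  assumes "finite I"
    and "\<And>t x. x \<in> X \<Longrightarrow> q t x = (\<Sum>i\<in>I. c t i * e i x)"
    and "\<And>x. x \<in> X \<Longrightarrow> ((\<lambda>t. q t x) \<longlongrightarrow> l x) F"
    and "F \<noteq> bot"
  shows "\<exists>d. \<forall>x\<in>X. l x = (\<Sum>i\<in>I. d i * e i x)"
  using assms(1,2,3)
proof (induction I arbitrary: e q l rule: finite_induct)
  case empty
  have "l x = 0" if "x \<in> X" for x
    using tendsto_unique[OF assms(4) empty(2)[OF that]] empty(1)[OF that] by simp
  then show ?case
    by simp
next
  case (insert j I)
  show ?case
  proof (cases "\<forall>x\<in>X. e j x = 0")
    case True
    then obtain d where "\<forall>x\<in>X. l x = (\<Sum>i\<in>I. d i * e i x)"
      using insert.IH[of q e l] insert.prems insert.hyps by auto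
    then show ?thesis using True insert.hyps by (intro exI[of _ d]) auto
  next
    case False
    then obtain x0 where x0: "x0 \<in> X" "e j x0 \<noteq> 0" by blast
    \<comment> \<open>Subtracting multiples of \<open>e j\<close> makes all these functions vanish
      at \<open>x0\<close> and eliminates the unknown coefficient \<open>c t j\<close>.\<close>
    define e' where "e' i x = e i x - e i x0 / e j x0 * e j x" for i x
    define q' where "q' t x = q t x - q t x0 / e j x0 * e j x" for t x
    define l' where "l' x = l x - l x0 / e j x0 * e j x" for x
    have q': "q' t x = (\<Sum>i\<in>I. c t i * e' i x)" if "x \<in> X" for t x
    proof -
      have "(\<Sum>i\<in>I. c t i * e' i x)
          = (\<Sum>i\<in>I. c t i * e i x) - (\<Sum>i\<in>I. c t i * e i x0) / e j x0 * e j x"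
        by (simp add: e'_def algebra_simps sum_subtractf sum_distrib_left sum_distrib_right
            sum_divide_distrib)
      then show ?thesis
        using insert.hyps insert.prems(1)[OF that] insert.prems(1)[OF x0(1)] x0
        by (simp add: q'_def field_simps)
    qed
    have l': "((\<lambda>t. q' t x) \<longlongrightarrow> l' x) F" if "x \<in> X" for x
      unfolding q'_def l'_def using x0 that by (intro tendsto_intros insert.prems)
    obtain d where d: "\<forall>x\<in>X. l' x = (\<Sum>i\<in>I. d i * e' i x)"
      using insert.IH[of q' e' l'] q' l' by blast
    \<comment> \<open>The coefficient of \<open>e j\<close> is the one that makes the identity hold
      at \<open>x0\<close>.\<close>
    define d' where "d' = d(j := (l x0 - (\<Sum>i\<in>I. d i * e i x0)) / e j x0)"
    have "l x = (\<Sum>i\<in>insert j I. d' i * e i x)" if "x \<in> X" for x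
    proof -
      have "(\<Sum>i\<in>I. d' i * e i x) = (\<Sum>i\<in>I. d i * e i x)"
        using insert.hyps by (intro sum.cong) (auto simp: d'_def)
      moreover have "(\<Sum>i\<in>I. d i * e' i x)
          = (\<Sum>i\<in>I. d i * e i x) - (\<Sum>i\<in>I. d i * e i x0) / e j x0 * e j x"
        by (simp add: e'_def algebra_simps sum_subtractf sum_distrib_left sum_distrib_right
            sum_divide_distrib)
      ultimately show ?thesis
        using d that insert.hyps x0 by (simp add: l'_def d'_def field_simps)
    qed
    then show ?thesis by blast
  qed
qed

text \<open>The monomials of degree below k form a finite family, so \<open>limit_in_span\<close>
  applies. The coefficients themselves are not claimed to converge, and X may be any set.\<close>

lemma poly_degree_less_limit:
  fixes q :: "'t \<Rightarrow> real^'n \<Rightarrow> real"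
  assumes "\<And>t. poly_degree_less k (q t)" "F \<noteq> bot"
    and "\<And>x. x \<in> X \<Longrightarrow> ((\<lambda>t. q t x) \<longlongrightarrow> l x) F"
  shows "\<exists>P. poly_degree_less k P \<and> (\<forall>x\<in>X. l x = P x)"
proof -
  let ?e = "\<lambda>\<alpha> x. \<Prod>i\<in>UNIV. (x $ i) ^ \<alpha> i"
  obtain c where "\<And>t x. q t x = (\<Sum>\<alpha> | sum \<alpha> UNIV < k. c t \<alpha> * ?e \<alpha> x)"
    using assms(1) unfolding poly_degree_less_def by metis
  then obtain d where "\<forall>x\<in>X. l x = (\<Sum>\<alpha> | sum \<alpha> UNIV < k. d \<alpha> * ?e \<alpha> x)"
    using limit_in_span[OF finite_multi_indices, where X = X and q = q and c = c and e = ?e and l = l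
        and F = F] assms(2,3) by blast
  then show ?thesis
    by (intro exI[of _ "\<lambda>x. \<Sum>\<alpha> | sum \<alpha> UNIV < k. d \<alpha> * ?e \<alpha> x"]) (auto simp: poly_degree_less_def)
qed

lemma poly_degree_less_diff:
  assumes "poly_degree_less k P" "poly_degree_less k Q"
  shows "poly_degree_less k (\<lambda>x. P x - Q x)"
proof -
  obtain c d where "\<And>x. P x = (\<Sum>\<alpha> | sum \<alpha> UNIV < k. c \<alpha> * (\<Prod>i\<in>UNIV. (x $ i) ^ \<alpha> i))"
    "\<And>x. Q x = (\<Sum>\<alpha> | sum \<alpha> UNIV < k. d \<alpha> * (\<Prod>i\<in>UNIV. (x $ i) ^ \<alpha> i))"
    using assms unfolding poly_degree_less_def by blast
  then show ?thesis unfolding poly_degree_less_def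
    by (intro exI[of _ "\<lambda>\<alpha>. c \<alpha> - d \<alpha>"]) (simp add: left_diff_distrib sum_subtractf)
qed

subsection \<open>Truncations\<close>

text \<open>On the ball of radius R the weight 1 + |y|^q is at most 1 + R^q, so the truncation is
  dominated by a multiple of the weighted function.\<close>

lemma truncation_integrable:
  fixes u :: "'a::euclidean_space \<Rightarrow> real"
  assumes u: "u \<in> borel_measurable lebesgue" and q: "0 \<le> q"
    and int: "integrable lebesgue (\<lambda>y. \<bar>u y\<bar> / (1 + norm y powr q))"
  shows "integrable lebesgue (\<lambda>y. indicator (ball 0 R) y * u y)"
proof (rule Bochner_Integration.integrable_bound)
  show "integrable lebesgue (\<lambda>y. (1 + R powr q) * (\<bar>u y\<bar> / (1 + norm y powr q)))"
    using int by (rule integrable_mult_right)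
  show "(\<lambda>y. indicator (ball 0 R) y * u y) \<in> borel_measurable lebesgue"
    using u by (intro borel_measurable_times borel_measurable_indicator) auto
  have "\<bar>indicator (ball 0 R) y * u y\<bar> \<le> (1 + R powr q) * (\<bar>u y\<bar> / (1 + norm y powr q))" for y
  proof (cases "norm y < R")
    case True
    have pos: "0 < 1 + norm y powr q" by (simp add: add_pos_nonneg)
    have "norm y powr q \<le> R powr q" using True q by (intro powr_mono2) auto
    then have "\<bar>u y\<bar> * (1 + norm y powr q) \<le> \<bar>u y\<bar> * (1 + R powr q)"
      by (intro mult_left_mono) auto
    then show ?thesis using True pos by (simp add: pos_le_divide_eq mult.commute)
  qed simp
  then show "AE y in lebesgue. norm (indicator (ball 0 R) y * u y)
      \<le> norm ((1 + R powr q) * (\<bar>u y\<bar> / (1 + norm y powr q)))"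
    by (intro AE_I2) (auto intro: order_trans)
qed

theorem lemma1p2:
  fixes s :: real and k :: nat and u f f' :: "real^'n \<Rightarrow> real"
  assumes "0 < s" and "s < 1"
    and "continuous_on (ball 0 1) u"
    and "u \<in> borel_measurable lebesgue"
    and "integrable lebesgue (\<lambda>y. \<bar>u y\<bar> / (1 + norm y powr (real CARD('n) + 2 * s + real k)))"
    and "frac_laplacian_eq_mod s k u f"
    and "frac_laplacian_eq_mod s k u f'"
  shows "\<exists>P. poly_degree_less k P \<and> (\<forall>x\<in>ball 0 1. f x - f' x = P x)"
proof -
  let ?w = "\<lambda>R y. indicator (ball 0 R) y * u y"
  obtain P F where P: "\<And>R. poly_degree_less k (P R)"
    and PF: "\<forall>\<^sub>F R in at_top. viscosity_solution s (ball 0 1) (?w R) (\<lambda>x. F R x + P R x)"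
    and F: "\<And>x. x \<in> ball 0 1 \<Longrightarrow> ((\<lambda>R. F R x) \<longlongrightarrow> f x) at_top"
    using assms(6) unfolding frac_laplacian_eq_mod_def by blast
  obtain P' F' where P': "\<And>R. poly_degree_less k (P' R)"
    and PF': "\<forall>\<^sub>F R in at_top. viscosity_solution s (ball 0 1) (?w R) (\<lambda>x. F' R x + P' R x)"
    and F': "\<And>x. x \<in> ball 0 1 \<Longrightarrow> ((\<lambda>R. F' R x) \<longlongrightarrow> f' x) at_top"
    using assms(7) unfolding frac_laplacian_eq_mod_def by blast
  have w: "integrable lebesgue (?w R)" for R
    using assms(1,4,5) by (intro truncation_integrable[where q = "real CARD('n) + 2 * s + real k"]) auto
  have "((\<lambda>R. P' R x - P R x) \<longlongrightarrow> f x - f' x) at_top" if x: "x \<in> ball 0 1" for x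
  proof (rule Lim_transform_eventually)
    show "((\<lambda>R. F R x - F' R x) \<longlongrightarrow> f x - f' x) at_top"
      by (intro tendsto_diff F F' x)
    show "\<forall>\<^sub>F R in at_top. F R x - F' R x = P' R x - P R x"
      using PF PF'
    proof eventually_elim
      case (elim R)
      then show ?case
        using viscosity_solution_unique_rhs[OF assms(1,2) w open_ball elim x] by simp
    qed
  qed
  \<comment> \<open>The differences P' - P are polynomials for every R, although they agree with F -
    F' only for large R; that suffices for the limit.\<close>
  then show ?thesis
    by (intro poly_degree_less_limit[where F = at_top and q = "\<lambda>R x. P' R x - P R x"]
        poly_degree_less_diff P P' trivial_limit_at_top_linorder)
qed

end
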